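(* Let $n\ge1$ and let $(f_{ij})_{0\le j\le i\le n-1}$ be the $f$-triangle of $\Delta_{\mathrm{Dyck}_n}$. (i) For $0\le j\le n-1$, the column sum $f_{j-1}=\sum_{i\ge0}f_{ij}$ is the Narayana number $N_{n,j+1}$. In particular, the $f$-vector $(f_{-1},\ldots,f_{n-2})$ of $\Delta_{\mathrm{Dyck}_n}$ is $(N_{n,1},\ldots,N_{n,n})$. (ii) For $0\le i\le n-1$, the sum of the entries in the $i$th row satisfies \[ \sum_{j=0}^{i}f_{ij}=\Big|\bigl\{\,w\in\mathrm{Dyck}_n : \mu(w)=i\,\bigr\}\Big| . \]
   Context: The Narayana numbers are $N_{n,k}=\frac1n\binom nk\binom n{k-1}$, $1\le k\le n$. A Dyck path of semilength $n$ is a word $w=w_1\cdots w_{2n}$ in $\{U,D\}$ with equally many $U$'s and $D$'s such that every prefix contains at least as many $U$'s as $D$'s; $\mathrm{Dyck}_n$ is the set of these. A valley of $w$ is an index $i$ with $w_i=D$, $w_{i+1}=U$, identified with its position $(i,y)$, where $y$ is the number of $U$'s minus the number of $D$'s in $w_1\cdots w_i$. $V(w)$ is the set of valley positions of $w$, and $\Delta_{\mathrm{Dyck}_n}=\{V(w):w\in\mathrm{Dyck}_n\}$, which is a simplicial complex of dimension $n-2$. For $w\in\mathrm{Dyck}_n$ with valleys $p_1,\ldots,p_\ell$ listed from left to right, let $p_0=(0,0)$ be the starting point and $p_{\ell+1}=(2n,0)$ the terminal point of $w$. For $1\le i\le\ell+1$ let $u_i$ and $d_i$ be the numbers of $U$-steps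 and $D$-steps in the portion of $w$ from $p_{i-1}$ to $p_i$. Define $\mu(w)=\Bigl(\sum_{i=1}^{\ell+1}\min\{u_i,d_i\}\Bigr)-1$. For a simplicial complex $\Delta$, $f_k$ is the number of faces of dimension $k$ (cardinality $k+1$). The degree of a face $\sigma$ is $\deg(\sigma)=\max\{|\tau| : \tau\in\Delta,\ \sigma\subseteq\tau\}$. The $f$-triangle of $\Delta$ is the array $(f_{ij})$ where $f_{ij}$ is the number of faces $\sigma$ with $|\sigma|=j$ and $\deg(\sigma)=i$. *)

theory Defs
  imports Complex_Main
begin

section \<open>Simplicial complexes\<close>

text \<open>A simplicial complex is represented by its set of faces, the empty face included.
  The notions below are meant for finite nonempty complexes with finite faces.\<close>

definition face_dim :: "'a set \<Rightarrow> int" where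
  "face_dim \<sigma> = int (card \<sigma>) - 1"

definition complex_dim :: "'a set set \<Rightarrow> int" where
  "complex_dim \<Delta> = Max (face_dim ` \<Delta>)"

definition f_number :: "'a set set \<Rightarrow> int \<Rightarrow> nat" where
  "f_number \<Delta> k = card {\<sigma> \<in> \<Delta>. face_dim \<sigma> = k}"

definition f_vector :: "'a set set \<Rightarrow> nat list" where
  "f_vector \<Delta> = map (f_number \<Delta>) [-1..complex_dim \<Delta>]"

definition face_degree :: "'a set set \<Rightarrow> 'a set \<Rightarrow> nat" where
  "face_degree \<Delta> \<sigma> = Max {card \<tau> | \<tau>. \<tau> \<in> \<Delta> \<and> \<sigma> \<subseteq> \<tau>}"

definition f_triangle :: "'a set set \<Rightarrow> nat \<Rightarrow> nat \<Rightarrow> nat" where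
  "f_triangle \<Delta> i j = card {\<sigma> \<in> \<Delta>. card \<sigma> = j \<and> face_degree \<Delta> \<sigma> = i}"

section \<open>Dyck paths\<close>

datatype step = U | D

definition height :: "step list \<Rightarrow> nat \<Rightarrow> int" where
  "height w i = int (count_list (take i w) U) - int (count_list (take i w) D)"

definition dyck :: "nat \<Rightarrow> step list set" where
  "dyck n = {w. length w = 2 * n \<and> count_list w U = count_list w D \<and>
     (\<forall>i \<le> length w. count_list (take i w) D \<le> count_list (take i w) U)}"

text \<open>Steps are numbered from \<open>1\<close> in the mathematics, whereas list indices start at \<open>0\<close>: the
  \<open>i\<close>-th step of \<open>w\<close> is \<open>w ! (i - 1)\<close>. A valley index \<open>i\<close> is thus also the number of
  steps preceding the valley, i.e. its horizontal coordinate.\<close>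

definition valleys :: "step list \<Rightarrow> nat set" where
  "valleys w = {i. 1 \<le> i \<and> i < length w \<and> w ! (i - 1) = D \<and> w ! i = U}"

definition valley_positions :: "step list \<Rightarrow> (nat \<times> int) set" where
  "valley_positions w = {(i, height w i) | i. i \<in> valleys w}"

definition dyck_complex :: "nat \<Rightarrow> (nat \<times> int) set set" where
  "dyck_complex n = valley_positions ` dyck n"

text \<open>Horizontal coordinates of \<open>p\<^sub>0, \<dots>, p\<^bsub>\<ell>+1\<^esub>\<close>: the starting point, the
  valleys from left to right, and the terminal point.\<close>

definition breakpoints :: "step list \<Rightarrow> nat list" where
  "breakpoints w = 0 # sorted_list_of_set (valleys w) @ [length w]"

definition segment :: "step list \<Rightarrow> nat \<Rightarrow> step list" where
  "segment w i = drop (breakpoints w ! (i - 1)) (take (breakpoints w ! i) w)"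

definition \<mu> :: "step list \<Rightarrow> int" where
  "\<mu> w = (\<Sum>i = 1..card (valleys w) + 1.
     int (min (count_list (segment w i) U) (count_list (segment w i) D))) - 1"

section \<open>Narayana numbers\<close>

definition narayana :: "nat \<Rightarrow> nat \<Rightarrow> real" where
  "narayana n k = 1 / real n * real (n choose k) * real (n choose (k - 1))"

end

theory Submission
  imports Defs
begin

text \<open>A Dyck path is determined by its valleys, since between consecutive breakpoints it has the
  form \<open>U\<^sup>u D\<^sup>d\<close>; hence faces of the complex correspond to Dyck paths. Counting ballot words by
  their numbers of \<open>U\<close>'s, \<open>D\<close>'s and valleys and by their last step gives a recursion solved by
  \<open>2 \<times> 2\<close> determinants of binomial coefficients, which yields the Narayana numbers.

  For the degree of \<open>V(w)\<close>, cut a path \<open>w'\<close> with \<open>V(w) \<subseteq> V(w')\<close> at the breakpoints of \<open>w\<close>. Each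
  piece starts with \<open>U\<close>, ends with \<open>D\<close> and contains \<open>u\<close> up-steps and \<open>d\<close> down-steps, so it has
  fewer than \<open>min u d\<close> inner valleys. Replacing each piece by \<open>U\<^bsup>u-m\<^esup>(UD)\<^sup>mD\<^bsup>d-m\<^esup>\<close> with
  \<open>m = min u d\<close> attains this bound, and the path stays nonnegative because no prefix of the
  replacement goes below both of its end points.\<close>

section \<open>Ballot words and their valleys\<close>

lemma count_U_D: "count_list w U + count_list w D = length w"
proof (induction w)
  case (Cons x w)
  then show ?case by (cases x) auto
qed simp

text \<open>The prefix condition of \<open>dyck\<close> without closure or a fixed length, so that
  it applies to unfinished paths as well.\<close>

definition ballot :: "step list \<Rightarrow> bool" where
  "ballot w \<longleftrightarrow> (\<forall>i \<le> length w. count_list (take i w) D \<le> count_list (take i w) U)"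

lemma dyck_iff: "w \<in> dyck n \<longleftrightarrow> ballot w \<and> count_list w U = n \<and> count_list w D = n"
  using count_U_D[of w] by (auto simp: dyck_def ballot_def)

lemma ballot_Nil [simp]: "ballot []"
  by (simp add: ballot_def)

lemma ballot_snoc:
  "ballot (w @ [x]) \<longleftrightarrow> ballot w \<and> count_list (w @ [x]) D \<le> count_list (w @ [x]) U"
proof -
  have "ballot (w @ [x]) \<longleftrightarrow> (\<forall>i \<le> length w. count_list (take i (w @ [x])) D \<le> count_list (take i (w @ [x])) U)
      \<and> count_list (w @ [x]) D \<le> count_list (w @ [x]) U"
    unfolding ballot_def by (auto simp: le_Suc_eq simp del: take_append)
  then show ?thesis by (simp add: ballot_def)
qed

lemma ballot_count: "ballot w \<Longrightarrow> count_list w D \<le> count_list w U"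
  unfolding ballot_def by (metis order_refl take_all)

lemma ballot_append_U: "ballot w \<Longrightarrow> ballot (w @ replicate k U)"
proof (induction k)
  case (Suc k)
  then show ?case
    using ballot_snoc[of "w @ replicate k U" U] ballot_count[OF Suc.IH]
    by (simp add: replicate_append_same)
qed simp

lemma count_replicate [simp]: "count_list (replicate k x) y = (if x = y then k else 0)"
  by (induction k) auto

lemma count_concat_UD [simp]: "count_list (concat (replicate m [U, D])) x = m"
  by (induction m) (cases x; auto)+

lemma ballot_append_UD: "ballot w \<Longrightarrow> ballot (w @ concat (replicate m [U, D]))"
proof (induction m arbitrary: w)
  case (Suc m)
  have "ballot ((w @ [U]) @ [D])"
    using Suc.prems ballot_count[OF Suc.prems] by (simp only: ballot_snoc) simp
  then show ?case using Suc.IH by fastforce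
qed simp

lemma ballot_append_D:
  "ballot w \<Longrightarrow> count_list w D + k \<le> count_list w U \<Longrightarrow> ballot (w @ replicate k D)"
proof (induction k)
  case (Suc k)
  then show ?case
    using ballot_snoc[of "w @ replicate k D" D] by (simp add: replicate_append_same)
qed simp

definition num_valleys :: "step list \<Rightarrow> nat" where
  "num_valleys w = card (valleys w)"

lemma valleys_Nil [simp]: "valleys [] = {}"
  by (simp add: valleys_def)

lemma finite_valleys [simp]: "finite (valleys w)"
  by (rule finite_subset[of _ "{..length w}"]) (auto simp: valleys_def)

text \<open>In \<^term>\<open>last (U # w)\<close> the empty word counts as a word ending in \<^term>\<open>U\<close>.\<close>

lemma valleys_snoc:
  "valleys (w @ [x]) = valleys w \<union> (if x = U \<and> last (U # w) = D then {length w} else {})"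
proof (cases "w = []")
  case False
  then have l: "last w = w ! (length w - 1)" "length w \<ge> 1"
    by (auto simp: last_conv_nth Suc_le_eq)
  show ?thesis
    unfolding valleys_def using False l
    by (auto simp: nth_append less_Suc_eq split: if_splits)
qed (auto simp: valleys_def)

lemma num_valleys_Nil [simp]: "num_valleys [] = 0"
  by (simp add: num_valleys_def)

lemma num_valleys_snoc:
  "num_valleys (w @ [x]) = num_valleys w + of_bool (x = U \<and> last (U # w) = D)"
proof -
  have "length w \<notin> valleys w" by (simp add: valleys_def)
  then show ?thesis by (simp add: num_valleys_def valleys_snoc)
qed

lemma num_valleys_append:
  "num_valleys (x @ y) = num_valleys x + num_valleys y + of_bool (last (U # x) = D \<and> y \<noteq> [] \<and> hd y = U)"
proof (induction y rule: rev_induct)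
  case (snoc z y)
  show ?case
    using snoc num_valleys_snoc[of "x @ y" z] num_valleys_snoc[of y z]
    by (cases "y = []") (auto simp: last_append)
qed simp

text \<open>Each valley uses its own \<open>D\<close>, and a final \<open>D\<close> belongs to no
  valley.\<close>

lemma num_valleys_le_D: "num_valleys w + of_bool (last (U # w) = D) \<le> count_list w D"
proof (induction w rule: rev_induct)
  case (snoc x w)
  then show ?case using num_valleys_snoc[of w x] by (cases x) auto
qed simp

text \<open>Each valley uses its own \<open>U\<close>, and an initial \<open>U\<close> belongs to no
  valley.\<close>

lemma num_valleys_le_U: "num_valleys w + of_bool (w \<noteq> [] \<and> hd w = U) \<le> count_list w U"
proof (induction w rule: rev_induct)
  case (snoc x w)
  then show ?case using num_valleys_snoc[of w x] by (cases x; cases "w = []") auto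
qed simp

text \<open>If no \<open>U\<close> directly follows a \<open>D\<close>, all \<open>U\<close>'s
  precede all \<open>D\<close>'s. The condition on \<open>hd\<close> reads: empty or starting with
  \<open>U\<close>.\<close>

lemma num_valleys_0_imp:
  "num_valleys w = 0 \<Longrightarrow> hd (w @ [U]) = U \<Longrightarrow> w = replicate (count_list w U) U @ replicate (count_list w D) D"
proof (induction w rule: rev_induct)
  case (snoc x w)
  have 0: "num_valleys w = 0" "\<not> (x = U \<and> last (U # w) = D)"
    using snoc.prems num_valleys_snoc[of w x] by auto
  have "hd (w @ [U]) = U" using snoc.prems by (cases w) auto
  with 0 snoc.IH have w: "w = replicate (count_list w U) U @ replicate (count_list w D) D" by simp
  show ?case
  proof (cases x)
    case U
    with 0 have "last (U # w) = U" by (metis step.exhaust)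
    \<comment> \<open>A nonempty run of \<open>D\<close>'s in the form given by \<open>w\<close>
      would be its end, but \<open>w\<close> is empty or ends in \<open>U\<close>.\<close>
    with w have "count_list w D = 0"
      by (metis (full_types) append_is_Nil_conv last.simps last_appendR last_replicate replicate_empty step.distinct(1))
    moreover from this have "w @ [U] = U # w" using w
      by (metis append_Nil2 replicate_0 replicate_append_same)
    ultimately show ?thesis using w U by simp
  next
    case D
    have "w @ [D] = replicate (count_list w U) U @ (replicate (count_list w D) D @ [D])"
      using w by (metis append.assoc)
    with D show ?thesis by (simp add: replicate_append_same)
  qed
qed simp

lemma valley_append:
  assumes "x \<noteq> []" "y \<noteq> []" "last x = D" "hd y = U"
  shows "length x \<in> valleys (x @ y)"
  using assms by (auto simp: valleys_def nth_append last_conv_nth hd_conv_nth Suc_le_eq)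

section \<open>Blocks and zigzags\<close>

text \<open>The shape of a piece cut out at valleys; two adjacent blocks always meet in a
  valley.\<close>

definition block :: "step list \<Rightarrow> bool" where
  "block s \<longleftrightarrow> s \<noteq> [] \<and> hd s = U \<and> last s = D"

lemma block_concat:
  "ss \<noteq> [] \<Longrightarrow> \<forall>s \<in> set ss. block s \<Longrightarrow> block (concat ss)"
  by (induction ss rule: list_nonempty_induct) (auto simp: block_def)

text \<open>Each junction of two blocks adds exactly one valley, so valleys plus one is
  additive.\<close>

lemma num_valleys_concat:
  "ss \<noteq> [] \<Longrightarrow> \<forall>s \<in> set ss. block s \<Longrightarrow> num_valleys (concat ss) + 1 = (\<Sum>s\<leftarrow>ss. num_valleys s + 1)"
proof (induction ss rule: list_nonempty_induct)
  case (cons s ss)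
  then have "block (concat ss)" using block_concat[of ss] by simp
  with cons show ?case by (auto simp: num_valleys_append block_def)
qed simp

text \<open>The summand of \<open>\<mu>\<close>.\<close>

definition min_count :: "step list \<Rightarrow> nat" where
  "min_count s = min (count_list s U) (count_list s D)"

text \<open>The first \<open>U\<close> and the last \<open>D\<close> of a block belong to no
  valley.\<close>

lemma num_valleys_block_le: "block s \<Longrightarrow> num_valleys s + 1 \<le> min_count s"
  using num_valleys_le_U[of s] num_valleys_le_D[of s] by (auto simp: block_def min_count_def)

text \<open>Rearranges a block so as to maximise its valleys. At most one of the two outer runs is
  nonempty, since \<open>m\<close> is the smaller letter count.\<close>

definition zigzag :: "step list \<Rightarrow> step list" where
  "zigzag s = (let m = min_count s in
     replicate (count_list s U - m) U @ concat (replicate m [U, D]) @ replicate (count_list s D - m) D)"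

lemma count_zigzag [simp]: "count_list (zigzag s) x = count_list s x"
  by (cases x) (auto simp: zigzag_def Let_def min_count_def)

lemma count_concat_zigzag [simp]: "count_list (concat (map zigzag ss)) x = count_list (concat ss) x"
  by (induction ss) auto

lemma length_concat_zigzag [simp]: "length (concat (map zigzag ss)) = length (concat ss)"
  by (metis count_U_D count_concat_zigzag)

lemma block_UD: "m > 0 \<Longrightarrow> block (concat (replicate m [U, D]))"
  by (rule block_concat) (auto simp: block_def)

lemma block_zigzag:
  assumes "block s"
  shows "block (zigzag s)"
proof -
  have "min_count s > 0" using num_valleys_block_le[OF assms] by simp
  from block_UD[OF this] show ?thesis
    unfolding block_def zigzag_def Let_def by (auto simp: hd_append last_append)
qed

lemma num_valleys_replicate [simp]: "num_valleys (replicate k x) = 0"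
  using num_valleys_le_U[of "replicate k x"] num_valleys_le_D[of "replicate k x"] by (cases x) auto

lemma num_valleys_UD: "m > 0 \<Longrightarrow> num_valleys (concat (replicate m [U, D])) + 1 = m"
proof -
  assume "m > 0"
  moreover have "num_valleys [U, D] = 0"
    using num_valleys_snoc[of "[]" U] num_valleys_snoc[of "[U]" D] by simp
  ultimately show ?thesis
    by (subst num_valleys_concat) (auto simp: block_def sum_list_replicate)
qed

text \<open>Equality in \<open>num_valleys_block_le\<close>: a run of \<open>U\<close>'s in front or
  of \<open>D\<close>'s behind creates no valley.\<close>

lemma num_valleys_zigzag:
  assumes "block s"
  shows "num_valleys (zigzag s) + 1 = min_count s"
proof -
  have m: "min_count s > 0" using num_valleys_block_le[OF assms] by simp
  show ?thesis
    using num_valleys_UD[OF m] block_UD[OF m]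
    by (auto simp: zigzag_def Let_def num_valleys_append block_def hd_append)
qed

text \<open>The heights rise, then oscillate without going below the level reached, then fall; hence
  the minimum is at one of the two ends.\<close>

lemma ballot_append_zigzag:
  assumes "ballot x" "count_list x D + count_list s D \<le> count_list x U + count_list s U"
  shows "ballot (x @ zigzag s)"
proof -
  let ?m = "min_count s"
  let ?y = "(x @ replicate (count_list s U - ?m) U) @ concat (replicate ?m [U, D])"
  have "ballot ?y" by (intro ballot_append_UD ballot_append_U assms)
  then have "ballot (?y @ replicate (count_list s D - ?m) D)"
    by (rule ballot_append_D) (use assms in \<open>auto simp: min_count_def\<close>)
  then show ?thesis by (simp add: zigzag_def Let_def)
qed

lemma ballot_concat_zigzag:
  "\<forall>k \<le> length ss. count_list (concat (take k ss)) D \<le> count_list (concat (take k ss)) U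
    \<Longrightarrow> ballot (concat (map zigzag ss))"
proof (induction ss rule: rev_induct)
  case (snoc s ss)
  have "\<forall>k \<le> length ss. count_list (concat (take k ss)) D \<le> count_list (concat (take k ss)) U"
  proof (intro allI impI)
    fix k assume "k \<le> length ss"
    then show "count_list (concat (take k ss)) D \<le> count_list (concat (take k ss)) U"
      using snoc.prems[rule_format, of k] by simp
  qed
  with snoc.IH have "ballot (concat (map zigzag ss))" by blast
  moreover have "count_list (concat ss) D + count_list s D \<le> count_list (concat ss) U + count_list s U"
    using snoc.prems[rule_format, of "length (ss @ [s])"] by simp
  ultimately show ?case using ballot_append_zigzag by simp
qed simp

section \<open>Counting by valleys\<close>

text \<open>The last letter is recorded because it decides whether appending \<open>U\<close>
  creates a valley; the empty word belongs to class \<open>U\<close>.\<close>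

definition prefixes :: "step \<Rightarrow> nat \<Rightarrow> nat \<Rightarrow> nat \<Rightarrow> step list set" where
  "prefixes x p q v = {w. ballot w \<and> count_list w U = p \<and> count_list w D = q \<and>
     num_valleys w = v \<and> last (U # w) = x}"

lemma finite_step_lists: "finite {w :: step list. length w = m}"
proof -
  have "finite (UNIV :: step set)"
    by (rule finite_subset[of _ "{U, D}"]) (auto intro: step.exhaust)
  then show ?thesis using finite_lists_length_eq[of "UNIV :: step set" m] by simp
qed

lemma finite_prefixes [simp]: "finite (prefixes x p q v)"
  by (rule finite_subset[OF _ finite_step_lists[of "p + q"]])
    (auto simp: prefixes_def count_U_D[symmetric])

lemma prefixes_U_0: "card (prefixes U 0 q v) = of_bool (q = 0 \<and> v = 0)"
proof -
  have "prefixes U 0 q v = (if q = 0 \<and> v = 0 then {[]} else {})"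
    \<comment> \<open>A ballot word without \<open>U\<close> has no \<open>D\<close> either, so it
      is empty.\<close>
    unfolding prefixes_def using ballot_count count_U_D
    by (auto) (metis (full_types) add_0 le_zero_eq length_0_conv num_valleys_Nil)+
  then show ?thesis by simp
qed

lemma prefixes_D_0: "card (prefixes D p 0 v) = 0"
proof -
  have "prefixes D p 0 v = {}"
    unfolding prefixes_def using num_valleys_le_D
    by (auto simp del: last.simps) (metis add_is_0 le_zero_eq of_bool_eq_1_iff zero_neq_one)
  then show ?thesis by simp
qed

lemma prefixes_gt: "p < q \<Longrightarrow> prefixes x p q v = {}"
  using ballot_count by (fastforce simp: prefixes_def)

text \<open>Turns a description by the last letter into an injective image, from which the
  recursions for cardinalities follow.\<close>

lemma snoc_image:
  assumes "\<And>w. w @ [x] \<in> A \<longleftrightarrow> w \<in> B" "[] \<notin> A" "\<And>w. w \<in> A \<Longrightarrow> last w = x"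
  shows "A = (\<lambda>w. w @ [x]) ` B"
proof (intro equalityI subsetI)
  fix w assume "w \<in> A"
  moreover from this have "w = butlast w @ [x]"
    using assms(2,3) by (metis append_butlast_last_id)
  ultimately show "w \<in> (\<lambda>w. w @ [x]) ` B" using assms(1) by (metis image_eqI)
qed (use assms(1) in auto)

lemma prefixes_disjoint: "prefixes U p q v \<inter> prefixes D p' q' v' = {}"
  by (auto simp: prefixes_def)

text \<open>Deleting the final \<open>U\<close> loses a valley exactly when the remaining word ends
  in \<open>D\<close>.\<close>

lemma prefixes_U_Suc:
  "card (prefixes U (Suc p) q v) =
    card (prefixes U p q v) + (case v of 0 \<Rightarrow> 0 | Suc v' \<Rightarrow> card (prefixes D p q v'))"
proof -
  let ?D = "case v of 0 \<Rightarrow> {} | Suc v' \<Rightarrow> prefixes D p q v'"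
  have "prefixes U (Suc p) q v = (\<lambda>w. w @ [U]) ` (prefixes U p q v \<union> ?D)"
  proof (rule snoc_image)
    fix w
    show "w @ [U] \<in> prefixes U (Suc p) q v \<longleftrightarrow> w \<in> prefixes U p q v \<union> ?D"
      using ballot_count[of w]
      by (cases "last (U # w)") (auto simp: prefixes_def ballot_snoc num_valleys_snoc split: nat.splits)
  qed (auto simp: prefixes_def split: if_splits)
  moreover have "card (prefixes U p q v \<union> ?D) =
      card (prefixes U p q v) + (case v of 0 \<Rightarrow> 0 | Suc v' \<Rightarrow> card (prefixes D p q v'))"
    by (subst card_Un_disjoint) (auto simp: prefixes_disjoint split: nat.splits)
  ultimately show ?thesis by (simp add: card_image inj_on_def)
qed

text \<open>A final \<open>D\<close> never completes a valley; \<open>Suc q \<le> p\<close> is the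
  ballot condition at the new end point.\<close>

lemma prefixes_D_Suc:
  assumes "Suc q \<le> p"
  shows "card (prefixes D p (Suc q) v) = card (prefixes U p q v) + card (prefixes D p q v)"
proof -
  have "prefixes D p (Suc q) v = (\<lambda>w. w @ [D]) ` (prefixes U p q v \<union> prefixes D p q v)"
  proof (rule snoc_image)
    fix w
    show "w @ [D] \<in> prefixes D p (Suc q) v \<longleftrightarrow> w \<in> prefixes U p q v \<union> prefixes D p q v"
      using assms
      by (cases "last (U # w)") (auto simp: prefixes_def ballot_snoc num_valleys_snoc)
  qed (auto simp: prefixes_def split: if_splits)
  moreover have "card (prefixes U p q v \<union> prefixes D p q v) = card (prefixes U p q v) + card (prefixes D p q v)"
    by (rule card_Un_disjoint) (auto simp: prefixes_disjoint)
  ultimately show ?thesis by (simp add: card_image inj_on_def)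
qed

lemma card_prefixes_U_no_D: "card (prefixes U p 0 v) = of_bool (v = 0)"
  by (induction p) (auto simp: prefixes_U_0 prefixes_U_Suc prefixes_D_0 split: nat.splits)

lemma card_prefixes_U_no_valley: "card (prefixes U p (Suc q) 0) = 0"
  by (induction p) (auto simp: prefixes_U_0 prefixes_U_Suc)

text \<open>The only such word is a run of \<open>U\<close>'s followed by a run of
  \<open>D\<close>'s.\<close>

lemma card_prefixes_D_no_valley: "q \<le> p \<Longrightarrow> card (prefixes D (Suc p) (Suc q) 0) = 1"
  by (induction q) (auto simp: prefixes_D_Suc prefixes_D_0 card_prefixes_U_no_D card_prefixes_U_no_valley)

text \<open>Both determinants satisfy the recursions of the counts: Pascal's rule in
  \<open>p\<close> gives the one for a final \<open>U\<close>, Pascal's rule in \<open>q\<close> the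
  one for a final \<open>D\<close>.\<close>

lemma card_prefixes:
  "q \<le> p \<Longrightarrow>
    int (card (prefixes U (Suc p) (Suc q) (Suc v))) =
      int (p choose Suc v) * int (q choose v) - int (p choose v) * int (q choose Suc v) \<and>
    int (card (prefixes D (Suc p) (Suc q) (Suc v))) =
      int (p choose Suc v) * int (q choose Suc v) - int (p choose v) * int (q choose Suc (Suc v))"
proof (induction "p + q" arbitrary: p q v rule: less_induct)
  case less
  have U: "int (card (prefixes U (Suc p) (Suc q) (Suc v))) =
      int (p choose Suc v) * int (q choose v) - int (p choose v) * int (q choose Suc v)"
  proof (cases "p = q")
    case True
    \<comment> \<open>On the diagonal both predecessor classes have more \<open>D\<close>'s than
      \<open>U\<close>'s; the determinant vanishes too.\<close>
    have "prefixes U p (Suc q) (Suc v) = {}" "prefixes D p (Suc q) v = {}"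
      using True by (auto simp: prefixes_gt)
    then show ?thesis using True by (simp add: prefixes_U_Suc)
  next
    case False
    then obtain p' where p: "p = Suc p'" "q \<le> p'"
      using less.prems by (cases p) auto
    have 1: "int (card (prefixes U p (Suc q) (Suc v))) =
      int (p' choose Suc v) * int (q choose v) - int (p' choose v) * int (q choose Suc v)"
      using less.hyps[of p' q v] p by simp
    show ?thesis
    proof (cases v)
      \<comment> \<open>The predecessors ending in \<open>D\<close> have no valley here, which the
        induction hypothesis does not cover.\<close>
      case 0
      then show ?thesis using 1 p by (simp add: prefixes_U_Suc[of "Suc p'"] card_prefixes_D_no_valley)
    next
      case (Suc v')
      have 2: "int (card (prefixes D p (Suc q) v)) =
        int (p' choose v) * int (q choose v) - int (p' choose v') * int (q choose Suc v)"
        using less.hyps[of p' q v'] p Suc by simp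
      show ?thesis using 1 2 p Suc
        by (simp add: prefixes_U_Suc[of "Suc p'"]) (simp add: algebra_simps)
    qed
  qed
  have Dd: "int (card (prefixes D (Suc p) (Suc q) (Suc v))) =
      int (p choose Suc v) * int (q choose Suc v) - int (p choose v) * int (q choose Suc (Suc v))"
  proof (cases q)
    case 0
    then show ?thesis by (simp add: prefixes_D_Suc prefixes_D_0 card_prefixes_U_no_D)
  next
    case (Suc q')
    have "int (card (prefixes U (Suc p) q (Suc v))) =
      int (p choose Suc v) * int (q' choose v) - int (p choose v) * int (q' choose Suc v)"
      "int (card (prefixes D (Suc p) q (Suc v))) =
      int (p choose Suc v) * int (q' choose Suc v) - int (p choose v) * int (q' choose Suc (Suc v))"
      using less.hyps[of p q' v] less.prems Suc by auto
    moreover have "Suc q \<le> Suc p" using less.prems by simp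
    ultimately show ?thesis using Suc
      by (simp add: prefixes_D_Suc[of "Suc q'"]) (simp add: algebra_simps)
  qed
  show ?case using U Dd by blast
qed

section \<open>Narayana numbers as binomial determinants\<close>

lemma narayana_Suc_0: "narayana (Suc m) 1 = 1"
  by (simp add: narayana_def)

text \<open>Pascal's rule writes the two binomials of the Narayana number as \<open>b + c\<close>
  and \<open>a + b\<close>; the absorption identity gives two linear relations between these sums
  and \<open>a\<close>, \<open>b\<close>.\<close>

lemma narayana_binomial_det:
  "narayana (Suc m) (Suc (Suc v)) =
    real (m choose Suc v) ^ 2 - real (m choose v) * real (m choose Suc (Suc v))"
proof -
  define a b c where "a = real (m choose v)" and "b = real (m choose Suc v)" and "c = real (m choose Suc (Suc v))"
  have 1: "real (Suc m choose Suc (Suc v)) = b + c" "real (Suc m choose Suc v) = a + b"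
    by (simp_all add: a_def b_def c_def)
  have 2: "real (Suc (Suc v)) * (b + c) = real (Suc m) * b" "real (Suc v) * (a + b) = real (Suc m) * a"
    using arg_cong[OF Suc_times_binomial[of "Suc v" m], of real]
      arg_cong[OF Suc_times_binomial[of v m], of real]
    unfolding a_def b_def c_def by (simp_all add: algebra_simps)
  have "(b + c) * (a + b) = real (Suc m) * (b ^ 2 - a * c)"
  proof -
    \<comment> \<open>By the two absorption relations both sides equal
      \<open>real (Suc m) * a * b\<close>.\<close>
    have "a * (real (Suc (Suc v)) * (b + c)) = b * (real (Suc v) * (a + b))"
      unfolding 2 by (simp add: algebra_simps)
    then have 3: "real (Suc v) * (b ^ 2 - a * c) = a * (b + c)"
      by (simp add: algebra_simps power2_eq_square)
    have "real (Suc m) * (b ^ 2 - a * c) = b * (real (Suc m) * b) - c * (real (Suc m) * a)"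
      by (simp add: algebra_simps power2_eq_square)
    also have "\<dots> = b * (real (Suc (Suc v)) * (b + c)) - c * (real (Suc v) * (a + b))"
      unfolding 2 ..
    also have "\<dots> = real (Suc v) * (b ^ 2 - a * c) + b ^ 2 + b * c"
      by (simp add: algebra_simps power2_eq_square)
    finally show ?thesis unfolding 3 by (simp add: algebra_simps power2_eq_square)
  qed
  then show ?thesis
    unfolding narayana_def 1 by (simp add: a_def b_def c_def 1 field_simps)
qed

text \<open>A first \<open>D\<close> would make the height negative at once; a last \<open>U\<close>
  would need a negative height just before it.\<close>

lemma block_dyck:
  assumes "w \<in> dyck n" "n \<ge> 1"
  shows "block w"
proof -
  have ne: "w \<noteq> []" using assms by (auto simp: dyck_iff)
  then obtain x y where w: "w = x # y" by (cases w) auto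
  have "count_list (take 1 w) D \<le> count_list (take 1 w) U"
    using assms w unfolding dyck_iff ballot_def by (metis le_add1 length_Cons plus_1_eq_Suc)
  then have hd: "hd w = U" using w by (cases x) auto
  obtain y' x' where w': "w = y' @ [x']" using ne by (cases w rule: rev_cases) auto
  have "count_list y' D \<le> count_list y' U"
    using assms w' ballot_snoc ballot_count by (metis dyck_iff)
  then have "last w = D" using assms w' by (cases x') (auto simp: dyck_iff)
  with ne hd show ?thesis by (simp add: block_def)
qed

text \<open>Nonempty Dyck paths end in \<open>D\<close>, so this is the diagonal case of the
  determinant for \<open>prefixes D\<close>.\<close>

lemma card_dyck_valleys:
  assumes "n \<ge> 1"
  shows "real (card {w \<in> dyck n. num_valleys w = v}) = narayana n (v + 1)"
proof -
  obtain m where n: "n = Suc m" using assms by (cases n) auto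
  have last: "last (U # w) = D" if "w \<in> dyck n" for w
    using block_dyck[OF that assms] by (simp add: block_def)
  have "{w \<in> dyck n. num_valleys w = v} = prefixes D n n v"
    using last unfolding dyck_iff prefixes_def by blast
  moreover have "real (card (prefixes D n n v)) = narayana n (v + 1)"
  proof (cases v)
    case 0
    then show ?thesis using n narayana_Suc_0[of m] by (simp add: card_prefixes_D_no_valley)
  next
    case (Suc v')
    have "real_of_int (int (card (prefixes D n n v))) = narayana n (v + 1)"
      using card_prefixes[of m m v'] unfolding n Suc
      by (simp only: narayana_binomial_det Suc_eq_plus1[symmetric]) (simp add: power2_eq_square)
    then show ?thesis by simp
  qed
  ultimately show ?thesis by simp
qed

section \<open>Cutting a path at valleys\<close>

text \<open>Generalises \<open>breakpoints\<close> to any set of positions, so that one path can be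
  cut at the valleys of another.\<close>

definition cuts :: "nat set \<Rightarrow> nat \<Rightarrow> nat list" where
  "cuts A m = 0 # sorted_list_of_set A @ [m]"

definition slices :: "nat list \<Rightarrow> 'a list \<Rightarrow> 'a list list" where
  "slices bs w = map (\<lambda>i. drop (bs ! i) (take (bs ! Suc i) w)) [0..<length bs - 1]"

lemma length_slices [simp]: "length (slices bs w) = length bs - 1"
  by (simp add: slices_def)

lemma nth_slices: "i < length bs - 1 \<Longrightarrow> slices bs w ! i = drop (bs ! i) (take (bs ! Suc i) w)"
  by (simp add: slices_def)

text \<open>Consecutive slices abut, so their concatenation telescopes.\<close>

lemma concat_take_slices:
  assumes "sorted bs" "bs ! 0 = 0" "k < length bs"
  shows "concat (take k (slices bs w)) = take (bs ! k) w"
  using assms(3)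
proof (induction k)
  case 0
  then show ?case using assms by simp
next
  case (Suc k)
  have "bs ! k \<le> bs ! Suc k" using assms(1) Suc.prems by (simp add: sorted_iff_nth_mono)
  then have "take (bs ! Suc k) w = take (bs ! k) w @ drop (bs ! k) (take (bs ! Suc k) w)"
    by (metis append_take_drop_id min.absorb1 take_take)
  with Suc show ?case by (simp add: take_Suc_conv_app_nth nth_slices)
qed

context
  fixes A :: "nat set" and m :: nat
  assumes A: "A \<subseteq> {0<..<m}" and m: "m > 0"
begin

lemma finite_cut_set: "finite A"
  using A finite_subset by blast

lemma strict_cuts: "sorted_wrt (<) (cuts A m)"
  using A m finite_cut_set by (auto simp: cuts_def sorted_wrt_append)

lemma sorted_cuts: "sorted (cuts A m)"
  using strict_cuts strict_sorted_imp_sorted by blast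

lemma length_cuts: "length (cuts A m) = card A + 2"
  using finite_cut_set by (simp add: cuts_def)

lemma cuts_0: "cuts A m ! 0 = 0"
  by (simp add: cuts_def)

lemma cuts_last: "cuts A m ! (card A + 1) = m"
  using finite_cut_set by (simp add: cuts_def nth_append)

lemma cuts_less: "i < j \<Longrightarrow> j < card A + 2 \<Longrightarrow> cuts A m ! i < cuts A m ! j"
  using strict_cuts length_cuts by (simp add: sorted_wrt_iff_nth_less)

lemma cuts_mem: "0 < i \<Longrightarrow> i \<le> card A \<Longrightarrow> cuts A m ! i \<in> A"
proof -
  assume i: "0 < i" "i \<le> card A"
  then obtain j where j: "i = Suc j" "j < card A" by (cases i) auto
  then have "cuts A m ! i = sorted_list_of_set A ! j"
    using finite_cut_set by (simp add: cuts_def nth_append)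
  also have "\<dots> \<in> set (sorted_list_of_set A)" using j finite_cut_set by (intro nth_mem) simp
  finally show ?thesis using finite_cut_set by simp
qed

lemma cuts_surj:
  assumes "x \<in> A"
  obtains k where "0 < k" "k \<le> card A" "x = cuts A m ! k"
proof -
  obtain j where "j < card A" "sorted_list_of_set A ! j = x"
    using assms finite_cut_set by (metis in_set_conv_nth length_sorted_list_of_set set_sorted_list_of_set)
  then show ?thesis using that[of "Suc j"] finite_cut_set by (auto simp: cuts_def nth_append)
qed

lemma cuts_gap:
  assumes "x \<in> A" "i \<le> card A" "cuts A m ! i < x" "x < cuts A m ! Suc i"
  shows False
proof -
  obtain k where k: "k \<le> card A" "x = cuts A m ! k" using cuts_surj[OF assms(1)] by metis
  with assms cuts_less[of k i] cuts_less[of "Suc i" k] have "\<not> k < i" "\<not> Suc i < k" by auto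
  then have "k = i \<or> k = Suc i" by auto
  with k assms show False by auto
qed

lemma cuts_le: "i \<le> card A + 1 \<Longrightarrow> cuts A m ! i \<le> m"
  using cuts_less[of i "card A + 1"] cuts_last by (cases "i = card A + 1") auto

lemma concat_take_slices_cuts: "k \<le> card A + 1 \<Longrightarrow> concat (take k (slices (cuts A m) w)) = take (cuts A m ! k) w"
  by (rule concat_take_slices) (simp_all add: sorted_cuts cuts_0 length_cuts)

lemma concat_slices_cuts: "length w = m \<Longrightarrow> concat (slices (cuts A m) w) = w"
  using concat_take_slices_cuts[of "card A + 1" w] cuts_last by (simp add: length_cuts)

text \<open>Letter counts of a slice depend only on the prefixes up to its two ends; this allows two
  paths to be compared piece by piece.\<close>

lemma count_slices_cuts:
  assumes "i \<le> card A"
  shows "count_list (slices (cuts A m) w ! i) x =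
    count_list (take (cuts A m ! Suc i) w) x - count_list (take (cuts A m ! i) w) x"
proof -
  have "concat (take (Suc i) (slices (cuts A m) w)) =
      concat (take i (slices (cuts A m) w)) @ slices (cuts A m) w ! i"
    using assms by (simp add: take_Suc_conv_app_nth length_cuts)
  then show ?thesis
    using assms by (simp add: concat_take_slices_cuts)
qed

text \<open>A cut at a valley lies between \<open>D\<close> and \<open>U\<close>, and the outer ends
  inherit their letters from \<open>w\<close>. Not every valley need be a cut.\<close>

lemma block_slices_cuts:
  assumes w: "block w" "length w = m" and sub: "A \<subseteq> valleys w"
  shows "\<forall>s \<in> set (slices (cuts A m) w). block s"
proof
  fix s assume "s \<in> set (slices (cuts A m) w)"
  then obtain i where i: "i \<le> card A" and s: "s = slices (cuts A m) w ! i"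
    by (auto simp: in_set_conv_nth length_cuts less_Suc_eq_le)
  let ?a = "cuts A m ! i" and ?b = "cuts A m ! Suc i"
  have ab: "?a < ?b" "?b \<le> m" using i cuts_less cuts_le by auto
  have s': "s = drop ?a (take ?b w)" using s i by (simp add: nth_slices length_cuts)
  have a: "w ! ?a = U"
  proof (cases "i = 0")
    case True
    then show ?thesis using w by (auto simp: block_def cuts_0 hd_conv_nth)
  next
    case False
    then show ?thesis using cuts_mem[of i] i sub by (auto simp: valleys_def)
  qed
  have b: "w ! (?b - 1) = D"
  proof (cases "i = card A")
    case True
    then show ?thesis using w cuts_last by (auto simp: block_def last_conv_nth)
  next
    case False
    then show ?thesis using cuts_mem[of "Suc i"] i sub by (auto simp: valleys_def)
  qed
  show "block s"
    using a b ab w(2) by (auto simp: s' block_def hd_drop_conv_nth last_conv_nth)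
qed

text \<open>A valley inside a slice would be a valley of \<open>w\<close> strictly between
  neighbouring cuts.\<close>

lemma num_valleys_slices_cuts:
  assumes w: "length w = m" and A_eq: "A = valleys w" and i: "i \<le> card A"
  shows "num_valleys (slices (cuts A m) w ! i) = 0"
proof -
  let ?a = "cuts A m ! i" and ?b = "cuts A m ! Suc i"
  have ab: "?a < ?b" "?b \<le> m" using i cuts_less cuts_le by auto
  have "valleys (drop ?a (take ?b w)) = {}"
  proof (rule ccontr)
    assume "valleys (drop ?a (take ?b w)) \<noteq> {}"
    then obtain j where j: "1 \<le> j" "j < ?b - ?a" "w ! (?a + (j - 1)) = D" "w ! (?a + j) = U"
      using ab w by (auto simp: valleys_def)
    then have "?a + j \<in> valleys w" using ab w by (auto simp: valleys_def)
    moreover have "?a < ?a + j" "?a + j < ?b" using j by linarith+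
    ultimately show False using cuts_gap[of "?a + j" i] i A_eq by blast
  qed
  then show ?thesis using i by (simp add: nth_slices length_cuts num_valleys_def)
qed

end

lemma valleys_subset: "valleys w \<subseteq> {0<..<length w}"
  by (auto simp: valleys_def)

abbreviation runs :: "step list \<Rightarrow> step list list" where
  "runs w \<equiv> slices (cuts (valleys w) (length w)) w"

text \<open>Segments are numbered from 1 and list entries from 0, so the sum is shifted by
  one.\<close>

lemma mu_eq:
  assumes "w \<noteq> []"
  shows "\<mu> w = int (\<Sum>s\<leftarrow>runs w. min_count s) - 1"
proof -
  note A = valleys_subset[of w]
  have m: "length w > 0" using assms by simp
  have l: "length (runs w) = card (valleys w) + 1" by (simp add: length_cuts[OF A m])
  have seg: "segment w (Suc i) = runs w ! i" if "i < card (valleys w) + 1" for i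
    using that by (simp add: segment_def breakpoints_def cuts_def[symmetric] nth_slices length_cuts[OF A m])
  have "(\<Sum>i = 1..card (valleys w) + 1. int (min_count (segment w i))) =
      (\<Sum>i = 0..<card (valleys w) + 1. int (min_count (segment w (Suc i))))"
    using sum.shift_bounds_Suc_ivl[of "\<lambda>i. int (min_count (segment w i))" 0 "card (valleys w) + 1"]
    by (simp add: atLeastLessThanSuc_atLeastAtMost)
  also have "\<dots> = (\<Sum>i = 0..<card (valleys w) + 1. int (min_count (runs w ! i)))"
    using seg by (intro sum.cong) auto
  also have "\<dots> = int (\<Sum>s\<leftarrow>runs w. min_count s)"
    using l by (simp add: sum_list_sum_nth)
  finally show ?thesis by (simp add: \<mu>_def min_count_def)
qed

lemma finite_dyck [simp]: "finite (dyck n)"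
  by (rule finite_subset[OF _ finite_step_lists[of "2 * n"]]) (auto simp: dyck_def)

section \<open>The complex of valley sets\<close>

lemma length_dyck: "w \<in> dyck n \<Longrightarrow> length w = 2 * n"
  by (simp add: dyck_def)

lemma card_valley_positions: "card (valley_positions w) = num_valleys w"
proof -
  have "valley_positions w = (\<lambda>i. (i, height w i)) ` valleys w"
    by (auto simp: valley_positions_def)
  then show ?thesis by (simp add: num_valleys_def card_image inj_on_def)
qed

text \<open>Height fixes the difference of the two letter counts of a prefix, its length their
  sum.\<close>

lemma count_take_eq:
  assumes "length w = length w'" "height w i = height w' i"
  shows "count_list (take i w) x = count_list (take i w') x"
  using assms count_U_D[of "take i w"] count_U_D[of "take i w'"]
  by (cases x) (auto simp: height_def)

lemma valley_positions_subset_iff: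
  "valley_positions w \<subseteq> valley_positions w' \<longleftrightarrow>
    valleys w \<subseteq> valleys w' \<and> (\<forall>i \<in> valleys w. height w i = height w' i)"
  by (auto simp: valley_positions_def)

text \<open>The two paths pass through the same point at every cut: at the valleys of
  \<open>w\<close> by inclusion, at the outer ends because both are in
  \<open>dyck n\<close>.\<close>

lemma count_slices_eq:
  assumes w: "w \<in> dyck n" "w' \<in> dyck n" and n: "n \<ge> 1"
    and sub: "valley_positions w \<subseteq> valley_positions w'"
    and i: "i \<le> card (valleys w)"
  shows "count_list (slices (cuts (valleys w) (2 * n)) w' ! i) x = count_list (runs w ! i) x"
proof -
  have A: "valleys w \<subseteq> {0<..<2 * n}" and m: "2 * n > 0"
    using valleys_subset[of w] length_dyck[OF w(1)] n by auto
  have *: "count_list (take (cuts (valleys w) (2 * n) ! k) w') x = count_list (take (cuts (valleys w) (2 * n) ! k) w) x"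
    if "k \<le> card (valleys w) + 1" for k
  proof -
    consider "k = 0" | "0 < k" "k \<le> card (valleys w)" | "k = card (valleys w) + 1"
      using \<open>k \<le> card (valleys w) + 1\<close> by linarith
    then show ?thesis
    proof cases
      case 1
      then show ?thesis by (simp add: cuts_0[OF A m])
    next
      case 2
      then have "cuts (valleys w) (2 * n) ! k \<in> valleys w" by (rule cuts_mem[OF A m])
      then show ?thesis
        using sub w by (intro count_take_eq) (auto simp: valley_positions_subset_iff length_dyck)
    next
      case 3
      then show ?thesis using w cuts_last[OF A m] length_dyck[OF w(1)] length_dyck[OF w(2)]
        by (cases x) (auto simp: dyck_iff)
    qed
  qed
  show ?thesis
    using *[of i] *[of "Suc i"] i by (simp add: count_slices_cuts[OF A m] length_dyck[OF w(1)])
qed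

lemma runs_eq:
  assumes w: "w \<in> dyck n" and n: "n \<ge> 1" and i: "i \<le> card (valleys w)"
  shows "runs w ! i = replicate (count_list (runs w ! i) U) U @ replicate (count_list (runs w ! i) D) D"
proof -
  have m: "length w > 0" using length_dyck[OF w] n by simp
  note A = valleys_subset[of w]
  have "num_valleys (runs w ! i) = 0"
    using i by (intro num_valleys_slices_cuts[OF A m]) auto
  moreover have "block (runs w ! i)"
    using block_slices_cuts[OF A m block_dyck[OF w n]] i by (simp add: length_cuts[OF A m])
  ultimately show ?thesis by (intro num_valleys_0_imp) (auto simp: block_def)
qed

text \<open>Equal valley positions force equal letter counts run by run, and each run is determined
  by its letter counts. Faces thus correspond to Dyck paths.\<close>

lemma inj_valley_positions:
  assumes n: "n \<ge> 1"
  shows "inj_on valley_positions (dyck n)"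
proof (rule inj_onI)
  fix w w' assume w: "w \<in> dyck n" "w' \<in> dyck n" and eq: "valley_positions w = valley_positions w'"
  have veq: "valleys w = valleys w'" using eq valley_positions_subset_iff by blast
  have len: "length w = 2 * n" "length w' = 2 * n" using w by (auto simp: length_dyck)
  have m: "length w > 0" "length w' > 0" using len n by auto
  have lr: "length (runs w) = card (valleys w) + 1" "length (runs w') = card (valleys w) + 1"
    using length_cuts[OF valleys_subset m(1)] length_cuts[OF valleys_subset m(2)] veq by auto
  have "runs w = runs w'"
  proof (rule nth_equalityI)
    fix i assume "i < length (runs w)"
    then have i: "i \<le> card (valleys w)" "i \<le> card (valleys w')" using lr veq by auto
    have "count_list (runs w' ! i) x = count_list (runs w ! i) x" for x
      using count_slices_eq[OF w n _ i(1)] eq veq len by simp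
    then show "runs w ! i = runs w' ! i"
      using runs_eq[OF w(1) n i(1)] runs_eq[OF w(2) n i(2)] by simp
  qed (use lr in simp)
  then show "w = w'"
    using concat_slices_cuts[OF valleys_subset m(1)] concat_slices_cuts[OF valleys_subset m(2)]
    by metis
qed

section \<open>Degrees of faces\<close>

lemma num_valleys_above_le:
  assumes w: "w \<in> dyck n" "w' \<in> dyck n" and n: "n \<ge> 1"
    and sub: "valley_positions w \<subseteq> valley_positions w'"
  shows "num_valleys w' + 1 \<le> (\<Sum>s\<leftarrow>runs w. min_count s)"
proof -
  have A: "valleys w \<subseteq> {0<..<2 * n}" and m: "2 * n > 0"
    using valleys_subset[of w] length_dyck[OF w(1)] n by auto
  let ?ss = "slices (cuts (valleys w) (2 * n)) w'"
  have l: "length ?ss = card (valleys w) + 1" by (simp add: length_cuts[OF A m])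
  have blocks: "\<forall>s \<in> set ?ss. block s"
    using sub by (intro block_slices_cuts[OF A m block_dyck[OF w(2) n]])
      (auto simp: valley_positions_subset_iff length_dyck[OF w(2)])
  have "num_valleys w' + 1 = num_valleys (concat ?ss) + 1"
    by (simp add: concat_slices_cuts[OF A m] length_dyck[OF w(2)])
  also have "\<dots> = (\<Sum>s\<leftarrow>?ss. num_valleys s + 1)"
  proof (rule num_valleys_concat)
    show "?ss \<noteq> []" using l by (metis add_is_0 list.size(3) one_neq_zero)
  qed (rule blocks)
  also have "\<dots> \<le> (\<Sum>s\<leftarrow>?ss. min_count s)"
    using blocks num_valleys_block_le by (intro sum_list_mono) auto
  \<comment> \<open>Corresponding pieces of \<open>w'\<close> and \<open>w\<close> have equal letter
    counts.\<close>
  also have "map min_count ?ss = map min_count (runs w)"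
    using count_slices_eq[OF w n sub] l
    by (intro nth_equalityI) (auto simp: min_count_def length_dyck[OF w(1)])
  finally show ?thesis .
qed

text \<open>The witness replaces every run of \<open>w\<close> by its zigzag, which attains the
  bound of \<open>num_valleys_above_le\<close>.\<close>

lemma exists_num_valleys_above:
  assumes w: "w \<in> dyck n" and n: "n \<ge> 1"
  shows "\<exists>w' \<in> dyck n. valley_positions w \<subseteq> valley_positions w' \<and>
    num_valleys w' + 1 = (\<Sum>s\<leftarrow>runs w. min_count s)"
proof -
  note A = valleys_subset[of w]
  have m: "length w > 0" using length_dyck[OF w] n by simp
  let ?ss = "runs w"
  define w' where "w' = concat (map zigzag ?ss)"
  have l: "length ?ss = card (valleys w) + 1" by (simp add: length_cuts[OF A m])
  have blocks: "\<forall>s \<in> set ?ss. block s"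
    by (intro block_slices_cuts[OF A m block_dyck[OF w n]]) auto
  then have zz: "\<forall>s \<in> set ?ss. block (zigzag s)" using block_zigzag by blast
  have w_eq: "concat ?ss = w" by (rule concat_slices_cuts[OF A m refl])
  have take_eq: "concat (take k ?ss) = take (cuts (valleys w) (length w) ! k) w" if "k \<le> length ?ss" for k
    using concat_take_slices_cuts[OF A m] that l by simp
  have "ballot w'"
    unfolding w'_def
  proof (intro ballot_concat_zigzag allI impI)
    \<comment> \<open>The first \<open>k\<close> runs form a prefix of \<open>w\<close>, so its
      ballot condition applies.\<close>
    fix k assume "k \<le> length ?ss"
    moreover have "cuts (valleys w) (length w) ! k \<le> length w"
      using cuts_le[OF A m] l \<open>k \<le> length ?ss\<close> by simp
    ultimately show "count_list (concat (take k ?ss)) D \<le> count_list (concat (take k ?ss)) U"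
      using w by (simp only: take_eq) (auto simp: dyck_iff ballot_def)
  qed
  then have "w' \<in> dyck n"
    using w by (simp add: dyck_iff w'_def w_eq)
  moreover have "num_valleys w' + 1 = (\<Sum>s\<leftarrow>?ss. min_count s)"
  proof -
    have "?ss \<noteq> []" using l by (metis add_is_0 list.size(3) one_neq_zero)
    then have "num_valleys w' + 1 = (\<Sum>s\<leftarrow>map zigzag ?ss. num_valleys s + 1)"
      unfolding w'_def using zz by (intro num_valleys_concat) auto
    also have "\<dots> = (\<Sum>s\<leftarrow>?ss. min_count s)"
      using blocks num_valleys_zigzag by (auto simp: o_def intro!: arg_cong[of _ _ sum_list])
    finally show ?thesis .
  qed
  moreover have "valley_positions w \<subseteq> valley_positions w'"
  proof -
    \<comment> \<open>At position \<open>i\<close> two zigzag blocks meet, giving a valley; zigzags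
      preserve letter counts, so the height there is unchanged.\<close>
    have "i \<in> valleys w' \<and> height w i = height w' i" if "i \<in> valleys w" for i
    proof -
      obtain k where k: "0 < k" "k \<le> card (valleys w)" "i = cuts (valleys w) (length w) ! k"
        using cuts_surj[OF A m \<open>i \<in> valleys w\<close>] by metis
      let ?x = "concat (map zigzag (take k ?ss))" and ?y = "concat (map zigzag (drop k ?ss))"
      have "?ss \<noteq> []" using l by (metis add_is_0 list.size(3) one_neq_zero)
      then have ne: "take k ?ss \<noteq> []" "drop k ?ss \<noteq> []" using k l by auto
      have "block ?x" "block ?y"
        using ne zz by (intro block_concat; auto dest: in_set_takeD in_set_dropD)+
      moreover have xy: "w' = ?x @ ?y"
        unfolding w'_def by (metis append_take_drop_id concat_append map_append)
      ultimately have v: "length ?x \<in> valleys w'"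
        using valley_append[of ?x ?y] by (simp add: block_def)
      have tk: "concat (take k ?ss) = take i w" using take_eq[of k] k l by simp
      have len: "length ?x = i" using tk \<open>i \<in> valleys w\<close> by (simp add: valleys_def)
      have "take i w' = ?x" using xy len by simp
      then have "height w i = height w' i" by (simp add: height_def tk)
      with v len show ?thesis by simp
    qed
    then show ?thesis by (auto simp: valley_positions_subset_iff)
  qed
  ultimately show ?thesis by blast
qed

lemma face_degree_dyck:
  assumes w: "w \<in> dyck n" and n: "n \<ge> 1"
  shows "int (face_degree (dyck_complex n) (valley_positions w)) = \<mu> w"
proof -
  let ?S = "{card \<tau> | \<tau>. \<tau> \<in> dyck_complex n \<and> valley_positions w \<subseteq> \<tau>}"
  obtain w' where w': "w' \<in> dyck n" "valley_positions w \<subseteq> valley_positions w'"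
    "num_valleys w' + 1 = (\<Sum>s\<leftarrow>runs w. min_count s)"
    using exists_num_valleys_above[OF w n] by blast
  have "Max ?S = num_valleys w'"
  proof (rule Max_eqI)
    have "?S \<subseteq> card ` dyck_complex n" by blast
    then show "finite ?S" by (rule finite_subset) (simp add: dyck_complex_def)
    show "num_valleys w' \<in> ?S"
      using w' by (auto simp: dyck_complex_def card_valley_positions[symmetric])
    fix y assume "y \<in> ?S"
    then show "y \<le> num_valleys w'"
      using num_valleys_above_le[OF w _ n] w'(3) by (fastforce simp: dyck_complex_def card_valley_positions)
  qed
  moreover have "w \<noteq> []" using length_dyck[OF w] n by auto
  ultimately show ?thesis using w'(3) by (simp add: face_degree_def mu_eq)
qed

lemma num_valleys_dyck_less:
  assumes "w \<in> dyck n" "n \<ge> 1"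
  shows "num_valleys w < n"
  using num_valleys_le_U[of w] block_dyck[OF assms] assms by (simp add: block_def dyck_iff)

text \<open>A face contains itself, and every face has fewer than \<open>n\<close> elements. These
  bounds make the finite row and column sums exhaustive.\<close>

lemma face_degree_dyck_bounds:
  assumes "w \<in> dyck n" "n \<ge> 1"
  shows "num_valleys w \<le> face_degree (dyck_complex n) (valley_positions w)"
    and "face_degree (dyck_complex n) (valley_positions w) < n"
proof -
  let ?S = "{card \<tau> | \<tau>. \<tau> \<in> dyck_complex n \<and> valley_positions w \<subseteq> \<tau>}"
  have "?S \<subseteq> card ` dyck_complex n" by blast
  then have fin: "finite ?S" by (rule finite_subset) (simp add: dyck_complex_def)
  have mem: "num_valleys w \<in> ?S"
    using assms by (auto simp: dyck_complex_def card_valley_positions[symmetric])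
  show "num_valleys w \<le> face_degree (dyck_complex n) (valley_positions w)"
    unfolding face_degree_def by (rule Max_ge[OF fin mem])
  have "Max ?S \<in> ?S" using fin mem by (intro Max_in) auto
  then show "face_degree (dyck_complex n) (valley_positions w) < n"
    using num_valleys_dyck_less assms(2)
    by (auto simp: face_degree_def dyck_complex_def card_valley_positions)
qed

section \<open>Face numbers and sums in the f-triangle\<close>

lemma f_number_dyck:
  assumes "n \<ge> 1"
  shows "real (f_number (dyck_complex n) (int j - 1)) = narayana n (j + 1)"
proof -
  have "{\<sigma> \<in> dyck_complex n. face_dim \<sigma> = int j - 1} = valley_positions ` {w \<in> dyck n. num_valleys w = j}"
    by (auto simp: dyck_complex_def face_dim_def card_valley_positions)
  moreover have "inj_on valley_positions {w \<in> dyck n. num_valleys w = j}"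
    using inj_valley_positions[OF assms] by (rule inj_on_subset) auto
  ultimately show ?thesis
    using card_dyck_valleys[OF assms, of j] by (simp add: f_number_def card_image)
qed

text \<open>Partitions the faces with \<open>j\<close> elements by degree.\<close>

lemma f_number_eq_sum_f_triangle:
  assumes "finite \<Delta>" "\<And>\<sigma>. \<sigma> \<in> \<Delta> \<Longrightarrow> face_degree \<Delta> \<sigma> \<le> m"
  shows "f_number \<Delta> (int j - 1) = (\<Sum>i = 0..m. f_triangle \<Delta> i j)"
proof -
  have "{\<sigma> \<in> \<Delta>. face_dim \<sigma> = int j - 1} =
      (\<Union>i\<in>{0..m}. {\<sigma> \<in> \<Delta>. card \<sigma> = j \<and> face_degree \<Delta> \<sigma> = i})"
    using assms(2) by (auto simp: face_dim_def)
  then show ?thesis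
    unfolding f_number_def f_triangle_def using assms(1)
    by (simp only:) (subst card_UN_disjoint; auto)
qed

text \<open>Partitions the faces of degree \<open>i\<close> by size, which is at most
  \<open>i\<close>.\<close>

lemma sum_row_f_triangle:
  assumes "finite \<Delta>" "\<And>\<sigma>. \<sigma> \<in> \<Delta> \<Longrightarrow> card \<sigma> \<le> face_degree \<Delta> \<sigma>"
  shows "(\<Sum>j = 0..i. f_triangle \<Delta> i j) = card {\<sigma> \<in> \<Delta>. face_degree \<Delta> \<sigma> = i}"
proof -
  have "{\<sigma> \<in> \<Delta>. face_degree \<Delta> \<sigma> = i} =
      (\<Union>j\<in>{0..i}. {\<sigma> \<in> \<Delta>. card \<sigma> = j \<and> face_degree \<Delta> \<sigma> = i})"
    using assms(2) by auto
  then show ?thesis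
    unfolding f_triangle_def using assms(1)
    by (simp only:) (subst card_UN_disjoint; auto)
qed

lemma complex_dim_dyck:
  assumes "n \<ge> 1"
  shows "complex_dim (dyck_complex n) = int n - 2"
  unfolding complex_dim_def
proof (rule Max_eqI)
  show "finite (face_dim ` dyck_complex n)" by (simp add: dyck_complex_def)
  show "y \<le> int n - 2" if "y \<in> face_dim ` dyck_complex n" for y
    using that num_valleys_dyck_less[OF _ assms]
    by (fastforce simp: dyck_complex_def face_dim_def card_valley_positions)
  \<comment> \<open>This path has \<open>n - 1\<close> valleys, the largest possible number.\<close>
  let ?w = "concat (replicate n [U, D])"
  have "?w \<in> dyck n" using ballot_append_UD[of "[]" n] by (simp add: dyck_iff)
  moreover have "face_dim (valley_positions ?w) = int n - 2"
    using num_valleys_UD[of n] assms by (simp add: face_dim_def card_valley_positions)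
  ultimately show "int n - 2 \<in> face_dim ` dyck_complex n"
    unfolding dyck_complex_def by (metis imageI)
qed

theorem corollary3p8:
  fixes n :: nat
  assumes "n \<ge> 1"
  shows "(\<forall>j \<le> n - 1.
            f_number (dyck_complex n) (int j - 1) = (\<Sum>i = 0..n - 1. f_triangle (dyck_complex n) i j) \<and>
            real (f_number (dyck_complex n) (int j - 1)) = narayana n (j + 1)) \<and>
         map real (f_vector (dyck_complex n)) = map (narayana n) [1..<n + 1] \<and>
         (\<forall>i \<le> n - 1.
            (\<Sum>j = 0..i. f_triangle (dyck_complex n) i j) = card {w \<in> dyck n. \<mu> w = int i})"
proof (intro conjI allI impI)
  have fin: "finite (dyck_complex n)" by (simp add: dyck_complex_def)
  show "f_number (dyck_complex n) (int j - 1) = (\<Sum>i = 0..n - 1. f_triangle (dyck_complex n) i j)" for j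
    using fin face_degree_dyck_bounds(2)[OF _ assms]
    by (intro f_number_eq_sum_f_triangle) (fastforce simp: dyck_complex_def)+
  show "real (f_number (dyck_complex n) (int j - 1)) = narayana n (j + 1)" for j
    by (rule f_number_dyck[OF assms])
  show "map real (f_vector (dyck_complex n)) = map (narayana n) [1..<n + 1]"
  proof (rule nth_equalityI)
    \<comment> \<open>The f-vector starts in dimension -1, so entry \<open>i\<close> counts faces
      with \<open>i\<close> elements.\<close>
    fix i assume "i < length (map real (f_vector (dyck_complex n)))"
    then have "i < n" using assms by (simp add: f_vector_def complex_dim_dyck)
    then show "map real (f_vector (dyck_complex n)) ! i = map (narayana n) [1..<n + 1] ! i"
      using f_number_dyck[OF assms, of i] assms
      by (simp add: f_vector_def complex_dim_dyck nth_upto del: upt_Suc)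
  qed (use assms in \<open>simp add: f_vector_def complex_dim_dyck\<close>)
  show "(\<Sum>j = 0..i. f_triangle (dyck_complex n) i j) = card {w \<in> dyck n. \<mu> w = int i}" for i
  proof -
    have "(\<Sum>j = 0..i. f_triangle (dyck_complex n) i j) =
        card {\<sigma> \<in> dyck_complex n. face_degree (dyck_complex n) \<sigma> = i}"
      using fin face_degree_dyck_bounds(1)[OF _ assms]
      by (intro sum_row_f_triangle) (auto simp: dyck_complex_def card_valley_positions)
    \<comment> \<open>Degree and \<open>\<mu>\<close> agree, and injectivity of
      \<open>valley_positions\<close> then carries the count over to paths.\<close>
    also have "{\<sigma> \<in> dyck_complex n. face_degree (dyck_complex n) \<sigma> = i} =
        valley_positions ` {w \<in> dyck n. \<mu> w = int i}"
      using face_degree_dyck[OF _ assms] by (force simp: dyck_complex_def)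
    also have "card \<dots> = card {w \<in> dyck n. \<mu> w = int i}"
      using inj_valley_positions[OF assms] by (intro card_image) (rule inj_on_subset, auto)
    finally show ?thesis .
  qed
qed

end
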